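(* Let $n=2^e p_1^{e_1}\cdots p_r^{e_r}\ge 2$ with $e\ge0$, $p_1,\dots,p_r$ distinct odd primes, $e_i\ge1$ (and $r\ge1$ if $e=0$). Let $A_1$, $A_0$, $K_n$ be as in the context. If $e=0$, the map $\rho_1:A_1\to K_n$ sending $(a_1,\dots,a_r)$ to the class modulo $w(n)$ of a solution $k$ of $x\equiv a_1\pmod{l_1},\dots,x\equiv a_r\pmod{l_r}$ is a (well-defined) bijection. If $e\ge1$, the map $\rho_0:A_0\to K_n$ sending $(a_0,a_1,\dots,a_r)$ to the class modulo $w(n)$ of a solution $k$ of $x\equiv a_0\pmod{l_0}, x\equiv a_1\pmod{l_1},\dots,x\equiv a_r\pmod{l_r}$ is a (well-defined) bijection.
   Context: For an integer $k\ge 1$, $D_k(x)=\sum_{j=0}^{\lfloor k/2\rfloor}\frac{k}{k-j}\binom{k-j}{j}(-1)^j x^{k-2j}$. Put $l_i=p_i^{e_i-1}\frac{p_i^2-1}{2}$ for $i=1,\dots,r$; if $e\ge1$, $l_0=3\cdot2^{e-1}$ if $1\le e<3$ and $l_0=3\cdot2^{e-2}$ if $e\ge3$. Let $w(n)=\mathrm{lcm}(l_1,\dots,l_r)$ if $e=0$ and $w(n)=\mathrm{lcm}(l_0,l_1,\dots,l_r)$ if $e\ge1$. For a modulus $q$ and an integer $L$ such that $D_k(u)\bmod q$ depends only on $k\bmod L$ (this holds for $(q,L)=(n,w(n))$, $(2^e,l_0)$ and $(p_i^{e_i},l_i)$), the kernel is the set of classes $k\in\mathbb{Z}_L^*$ with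 $D_k(u)\equiv u\pmod q$ for all integers $u$. So $K_n\subseteq\mathbb{Z}_{w(n)}^*$, $K_{2^e}\subseteq\mathbb{Z}_{l_0}^*$, $K_{p_i^{e_i}}\subseteq\mathbb{Z}_{l_i}^*$ (equivalently $K_n$ is the kernel of $\mathbb{Z}_{w(n)}^*\to G_n$, $k\mapsto(u\mapsto D_k(u))$, $G_n$ being the group of permutations of $\mathbb{Z}_n$ induced by Dickson permutation polynomials). Define $A_1=\{(a_1,\dots,a_r)\in K_{p_1^{e_1}}\times\cdots\times K_{p_r^{e_r}}:\ \text{the system } x\equiv a_i\pmod{l_i}\ (1\le i\le r)\text{ has a solution}\}$ and $A_0=\{(a_0,\dots,a_r)\in K_{2^e}\times K_{p_1^{e_1}}\times\cdots\times K_{p_r^{e_r}}:\ \text{the system } x\equiv a_i\pmod{l_i}\ (0\le i\le r)\text{ has a solution}\}$, where the congruences are understood for representatives of the classes $a_i$. *)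

theory Defs
  imports "HOL-Number_Theory.Number_Theory" "HOL-Library.FuncSet"
begin

text \<open>
  The quotient in the coefficient is exact for \<open>k \<ge> 1\<close> (see \<open>of_int_dickson\<close> below), so the
  truncating \<open>div\<close> does not change its value.
\<close>

definition dickson :: "nat \<Rightarrow> int \<Rightarrow> int" where
  "dickson k x =
     (\<Sum>j = 0..k div 2. int (k * ((k - j) choose j) div (k - j)) * (- 1) ^ j * x ^ (k - 2 * j))"

lemma dickson_coeff_dvd:
  assumes "k \<ge> 1" "j \<le> k div 2"
  shows "(k - j) dvd k * ((k - j) choose j)"
proof (cases j)
  case 0
  then show ?thesis by simp
next
  case (Suc i)
  obtain m where m: "k - j = Suc m"
    using assms Suc by (cases "k - j") auto
  have "k = Suc m + j"
    using m by simp
  then have "k * ((k - j) choose j) = Suc m * (Suc m choose Suc i) + Suc i * (Suc m choose Suc i)"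
    using m Suc by (simp only: add_mult_distrib)
  also have "Suc i * (Suc m choose Suc i) = Suc m * (m choose i)"
    by (rule Suc_times_binomial)
  finally show ?thesis
    using m by (metis dvd_add dvd_triv_left)
qed

lemma of_int_dickson:
  assumes "k \<ge> 1"
  shows "real_of_int (dickson k x) =
    (\<Sum>j = 0..k div 2. real k / real (k - j) * real ((k - j) choose j) * (- 1) ^ j
       * real_of_int x ^ (k - 2 * j))"
proof -
  have "real (k * ((k - j) choose j) div (k - j)) = real k / real (k - j) * real ((k - j) choose j)"
    if "j \<in> {0..k div 2}" for j
    using dickson_coeff_dvd[OF assms, of j] that by (simp add: real_of_nat_div)
  then show ?thesis
    unfolding dickson_def by (simp add: of_int_sum)
qed

text \<open>
  Throughout, \<open>e\<close> is the exponent of 2 and \<open>p i\<close>, \<open>f i\<close> (for \<open>1 \<le> i \<le> r\<close>) are the odd primes and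
  their exponents. Index 0 stands for the prime 2 and is only used when \<open>e \<ge> 1\<close>.
\<close>

definition prime_pow :: "nat \<Rightarrow> (nat \<Rightarrow> nat) \<Rightarrow> (nat \<Rightarrow> nat) \<Rightarrow> nat \<Rightarrow> nat" where
  "prime_pow e p f i = (if i = 0 then 2 ^ e else p i ^ f i)"

definition period :: "nat \<Rightarrow> (nat \<Rightarrow> nat) \<Rightarrow> (nat \<Rightarrow> nat) \<Rightarrow> nat \<Rightarrow> nat" where
  "period e p f i =
     (if i = 0 then (if e < 3 then 3 * 2 ^ (e - 1) else 3 * 2 ^ (e - 2))
      else p i ^ (f i - 1) * (((p i)\<^sup>2 - 1) div 2))"

definition w :: "nat \<Rightarrow> nat \<Rightarrow> (nat \<Rightarrow> nat) \<Rightarrow> (nat \<Rightarrow> nat) \<Rightarrow> nat" where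
  "w e r p f =
     (if e = 0 then Lcm (period e p f ` {1..r}) else Lcm (period e p f ` {0..r}))"

text \<open>
  Classes modulo \<open>L\<close> are represented by their least nonnegative residues, as in the carrier of
  \<open>residue_ring\<close>. All moduli \<open>L\<close> that occur are at least 3, so the representatives of units are
  positive and \<open>dickson (nat k)\<close> is only used for \<open>k \<ge> 1\<close>.
\<close>

definition dickson_kernel :: "nat \<Rightarrow> nat \<Rightarrow> int set" where
  "dickson_kernel q L =
     {k \<in> Units (residue_ring (int L)). \<forall>u::int. [dickson (nat k) u = u] (mod int q)}"

definition solves :: "nat set \<Rightarrow> (nat \<Rightarrow> nat) \<Rightarrow> (nat \<Rightarrow> int) \<Rightarrow> int \<Rightarrow> bool" where
  "solves I l a x \<longleftrightarrow> (\<forall>i\<in>I. [x = a i] (mod int (l i)))"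

definition compatible_tuples ::
  "nat set \<Rightarrow> (nat \<Rightarrow> nat) \<Rightarrow> (nat \<Rightarrow> nat) \<Rightarrow> (nat \<Rightarrow> int) set" where
  "compatible_tuples I q l =
     {a \<in> (\<Pi>\<^sub>E i\<in>I. dickson_kernel (q i) (l i)). \<exists>x. solves I l a x}"

definition A1 :: "nat \<Rightarrow> nat \<Rightarrow> (nat \<Rightarrow> nat) \<Rightarrow> (nat \<Rightarrow> nat) \<Rightarrow> (nat \<Rightarrow> int) set" where
  "A1 e r p f = compatible_tuples {1..r} (prime_pow e p f) (period e p f)"

definition A0 :: "nat \<Rightarrow> nat \<Rightarrow> (nat \<Rightarrow> nat) \<Rightarrow> (nat \<Rightarrow> nat) \<Rightarrow> (nat \<Rightarrow> int) set" where
  "A0 e r p f = compatible_tuples {0..r} (prime_pow e p f) (period e p f)"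

definition rho1 :: "nat \<Rightarrow> nat \<Rightarrow> (nat \<Rightarrow> nat) \<Rightarrow> (nat \<Rightarrow> nat) \<Rightarrow> (nat \<Rightarrow> int) \<Rightarrow> int" where
  "rho1 e r p f a = (SOME x. solves {1..r} (period e p f) a x) mod int (w e r p f)"

definition rho0 :: "nat \<Rightarrow> nat \<Rightarrow> (nat \<Rightarrow> nat) \<Rightarrow> (nat \<Rightarrow> nat) \<Rightarrow> (nat \<Rightarrow> int) \<Rightarrow> int" where
  "rho0 e r p f a = (SOME x. solves {0..r} (period e p f) a x) mod int (w e r p f)"

end

theory Submission
  imports Defs
begin

text \<open>
  For \<open>u = x + 1/x\<close> one has \<open>D_k(u) = x^k + x^{-k} = V_k(u)\<close>, a Lucas sequence whose companion is
  \<open>U_k(u) = (x^k - x^{-k}) / (x - 1/x)\<close>, and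
  \<open>V_{k+2m} - V_k = (u\<^sup>2 - 4) U_m U_{k+m}\<close>.
  Periodicity of the Dickson polynomials modulo \<open>p^f\<close> is therefore divisibility of
  \<open>(u\<^sup>2 - 4) U_m\<close> by \<open>p^f\<close>. For odd \<open>p\<close> this starts from \<open>D_p(u) \<equiv> u\<close> modulo \<open>p\<close>, which says that
  \<open>p\<close> divides \<open>(u\<^sup>2 - 4) U_{(p-1)/2} U_{(p+1)/2}\<close>, and each multiplication of the index by \<open>p\<close> gains
  a factor \<open>p\<close> because \<open>U_{pa}(u) = U_a(u) U_p(V_a(u))\<close> and \<open>U_p(v) \<equiv> 0\<close> when \<open>v \<equiv> \<plusminus>2\<close>.
  Given periodicity modulo each prime power, reduction modulo the \<open>l_i\<close> is inverse to solving the
  congruences.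
\<close>

section \<open>Lucas sequences\<close>

fun lucas_U :: "int \<Rightarrow> nat \<Rightarrow> int" where
  "lucas_U u 0 = 0"
| "lucas_U u (Suc 0) = 1"
| "lucas_U u (Suc (Suc k)) = u * lucas_U u (Suc k) - lucas_U u k"

fun lucas_V :: "int \<Rightarrow> nat \<Rightarrow> int" where
  "lucas_V u 0 = 2"
| "lucas_V u (Suc 0) = u"
| "lucas_V u (Suc (Suc k)) = u * lucas_V u (Suc k) - lucas_V u k"

lemma lucas_V_conv_U: "lucas_V u k = 2 * lucas_U u (Suc k) - u * lucas_U u k"
proof (induction u k rule: lucas_V.induct)
  case (3 u k)
  have "lucas_V u (Suc (Suc k)) = u * lucas_V u (Suc k) - lucas_V u k"
    by simp
  then show ?case
    unfolding 3 by (simp add: algebra_simps)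
qed simp_all

text \<open>The quadratic form \<open>X^2 - u * X * Y + Y^2\<close> is invariant under the
  recurrence step \<open>(Y, X)\<close> to \<open>(X, u * X - Y)\<close> and takes the value 1 at
  \<open>(0, 1)\<close>.\<close>

lemma lucas_U_cassini:
  "(lucas_U u (Suc k))\<^sup>2 - u * lucas_U u k * lucas_U u (Suc k) + (lucas_U u k)\<^sup>2 = 1"
  by (induction k) (simp_all add: algebra_simps power2_eq_square)

text \<open>Both sides satisfy the same recurrence in \<open>k\<close>. The first two terms together
  stand for \<open>- U_m U_{k-1}\<close>, written without a predecessor index.\<close>

lemma lucas_U_add:
  "lucas_U u (m + k) =
     lucas_U u m * lucas_U u (Suc k) - u * lucas_U u m * lucas_U u k + lucas_U u (Suc m) * lucas_U u k"
proof (induction u k rule: lucas_U.induct)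
  case (3 u k)
  have "lucas_U u (m + Suc (Suc k)) = u * lucas_U u (m + Suc k) - lucas_U u (m + k)"
    by simp
  then show ?case
    unfolding 3 by (simp add: algebra_simps)
qed simp_all

text \<open>For \<open>u = x + 1/x\<close> this reads
  \<open>(x^k + x^{-k})^2 - 4 = (x^k - x^{-k})^2\<close>, where
  \<open>u^2 - 4 = (x - 1/x)^2\<close>. It turns divisibility of the right side by a prime into
  \<open>V_k\<close> being 2 or -2 modulo that prime.\<close>

lemma lucas_V_square: "(lucas_V u k)\<^sup>2 - 4 = (u\<^sup>2 - 4) * (lucas_U u k)\<^sup>2"
proof -
  have "(lucas_V u k)\<^sup>2 - 4 - (u\<^sup>2 - 4) * (lucas_U u k)\<^sup>2 =
      4 * ((lucas_U u (Suc k))\<^sup>2 - u * lucas_U u k * lucas_U u (Suc k) + (lucas_U u k)\<^sup>2 - 1)"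
    by (simp add: lucas_V_conv_U algebra_simps power2_eq_square)
  then show ?thesis
    using lucas_U_cassini[of u k] by simp
qed

lemma lucas_V_shift_diff:
  "lucas_V u (k + 2 * m) - lucas_V u k = (u\<^sup>2 - 4) * lucas_U u m * lucas_U u (k + m)"
proof -
  \<comment> \<open>The cases \<open>k = 0\<close> and \<open>k = 1\<close> have to be proved
    jointly by induction on \<open>m\<close>; the recurrence in \<open>k\<close> then gives all
    others.\<close>
  have base: "lucas_V u (2 * m) - 2 = (u\<^sup>2 - 4) * (lucas_U u m)\<^sup>2 \<and>
        lucas_V u (Suc (2 * m)) - u = (u\<^sup>2 - 4) * lucas_U u m * lucas_U u (Suc m)"
  proof (induction m)
    case 0
    then show ?case by simp
  next
    case (Suc m)
    have c: "(lucas_U u (Suc m))\<^sup>2 = 1 + u * lucas_U u m * lucas_U u (Suc m) - (lucas_U u m)\<^sup>2"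
      using lucas_U_cassini[of u m] by simp
    have V0: "lucas_V u (2 * m) = 2 + (u\<^sup>2 - 4) * (lucas_U u m)\<^sup>2"
      and V1: "lucas_V u (Suc (2 * m)) = u + (u\<^sup>2 - 4) * lucas_U u m * lucas_U u (Suc m)"
      using Suc by simp_all
    have "lucas_V u (2 * Suc m) = u * lucas_V u (Suc (2 * m)) - lucas_V u (2 * m)"
      by simp
    also have "\<dots> = u * (u + (u\<^sup>2 - 4) * lucas_U u m * lucas_U u (Suc m))
        - (2 + (u\<^sup>2 - 4) * (lucas_U u m)\<^sup>2)"
      unfolding V0 V1 ..
    also have "\<dots> = 2 + (u\<^sup>2 - 4) * (lucas_U u (Suc m))\<^sup>2"
      unfolding c by (simp add: algebra_simps power2_eq_square)
    finally have V: "lucas_V u (2 * Suc m) = 2 + (u\<^sup>2 - 4) * (lucas_U u (Suc m))\<^sup>2" .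
    have "lucas_V u (Suc (2 * Suc m)) = u * lucas_V u (2 * Suc m) - lucas_V u (Suc (2 * m))"
      by simp
    also have "\<dots> = u * (2 + (u\<^sup>2 - 4) * (lucas_U u (Suc m))\<^sup>2)
        - (u + (u\<^sup>2 - 4) * lucas_U u m * lucas_U u (Suc m))"
      unfolding V V1 ..
    also have "\<dots> = u + (u\<^sup>2 - 4) * lucas_U u (Suc m) * lucas_U u (Suc (Suc m))"
      by (simp add: algebra_simps power2_eq_square)
    finally show ?case
      using V by simp
  qed
  have eq: "lucas_V u (k + 2 * m) = lucas_V u k + (u\<^sup>2 - 4) * lucas_U u m * lucas_U u (k + m)"
    using base
  proof (induction u k rule: lucas_V.induct)
    case (3 u k)
    have "lucas_V u (Suc (Suc k) + 2 * m) = u * lucas_V u (Suc k + 2 * m) - lucas_V u (k + 2 * m)"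
      by simp
    then show ?case
      unfolding 3(1)[OF 3(3)] 3(2)[OF 3(3)] by (simp add: algebra_simps)
  qed (simp_all add: algebra_simps power2_eq_square)
  show ?thesis
    unfolding eq by simp
qed

text \<open>This is the product of \<open>x^m + x^{-m}\<close> and
  \<open>x^{k+m} - x^{-(k+m)}\<close>, divided by \<open>x - 1/x\<close>. Read along an arithmetic
  progression of step \<open>m\<close>, it is a Lucas recurrence with parameter
  \<open>V_m\<close>.\<close>

lemma lucas_U_shift_sum:
  "lucas_U u (k + 2 * m) + lucas_U u k = lucas_V u m * lucas_U u (k + m)"
proof (induction u k rule: lucas_U.induct)
  case (1 u)
  have "lucas_U u (m + m) = lucas_V u m * lucas_U u m"
    unfolding lucas_U_add lucas_V_conv_U by (simp add: algebra_simps)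
  then show ?case
    by (simp add: mult_2)
next
  case (2 u)
  have "lucas_U u (Suc m + m) = (lucas_U u (Suc m))\<^sup>2 - (lucas_U u m)\<^sup>2"
    unfolding lucas_U_add by (simp add: algebra_simps power2_eq_square)
  moreover have "lucas_V u m * lucas_U u (Suc m) =
      2 * (lucas_U u (Suc m))\<^sup>2 - u * lucas_U u m * lucas_U u (Suc m)"
    unfolding lucas_V_conv_U by (simp add: algebra_simps power2_eq_square)
  ultimately have "lucas_U u (Suc m + m) + 1 = lucas_V u m * lucas_U u (Suc m)"
    using lucas_U_cassini[of u m] by linarith
  then show ?case
    by (simp add: mult_2)
next
  case (3 u k)
  have "lucas_U u (Suc (Suc k) + 2 * m) + lucas_U u (Suc (Suc k)) =
      u * (lucas_U u (Suc k + 2 * m) + lucas_U u (Suc k)) - (lucas_U u (k + 2 * m) + lucas_U u k)"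
    by (simp add: algebra_simps)
  then show ?case
    unfolding 3 by (simp add: algebra_simps)
qed

text \<open>As functions of \<open>j\<close>, both sides satisfy the recurrence with parameter
  \<open>lucas_V u a\<close> and have the values 0 and \<open>lucas_U u a\<close> at
  \<open>j = 0\<close> and \<open>j = 1\<close>.\<close>

lemma lucas_U_mult: "lucas_U u (j * a) = lucas_U u a * lucas_U (lucas_V u a) j"
proof -
  have "lucas_U u (j * a) = lucas_U u a * lucas_U (lucas_V u a) j \<and>
      lucas_U u (Suc j * a) = lucas_U u a * lucas_U (lucas_V u a) (Suc j)"
  proof (induction j)
    case 0
    then show ?case by simp
  next
    case (Suc j)
    then have IH: "lucas_U u (j * a) = lucas_U u a * lucas_U (lucas_V u a) j"
        "lucas_U u (Suc j * a) = lucas_U u a * lucas_U (lucas_V u a) (Suc j)"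
      by blast+
    have idx: "Suc (Suc j) * a = j * a + 2 * a" "Suc j * a = j * a + a"
      by simp_all
    have "lucas_U u (Suc (Suc j) * a) = lucas_V u a * lucas_U u (Suc j * a) - lucas_U u (j * a)"
      unfolding idx using lucas_U_shift_sum[of u "j * a" a] by linarith
    also have "\<dots> = lucas_U u a * lucas_U (lucas_V u a) (Suc (Suc j))"
      unfolding IH lucas_U.simps(3) by (simp only: algebra_simps)
    finally show ?case
      using IH(2) by blast
  qed
  then show ?thesis ..
qed

lemma lucas_U_dvd: "a dvd b \<Longrightarrow> lucas_U u a dvd lucas_U u b"
  by (elim dvdE) (simp add: lucas_U_mult mult.commute[of a])

lemma lucas_U_cong:
  assumes "[u = v] (mod m)"
  shows "[lucas_U u k = lucas_U v k] (mod m)"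
  using assms
proof (induction u k rule: lucas_U.induct)
  case (3 u k)
  then show ?case
    unfolding lucas_U.simps by (intro cong_diff cong_mult)
qed simp_all

lemma lucas_U_2: "lucas_U 2 k = int k"
proof -
  have "lucas_U 2 k = int k \<and> lucas_U 2 (Suc k) = int (Suc k)"
    by (induction k) auto
  then show ?thesis by simp
qed

lemma lucas_U_minus_2: "lucas_U (-2) k = (-1) ^ Suc k * int k"
proof -
  have "lucas_U (-2) k = (-1) ^ Suc k * int k \<and> lucas_U (-2) (Suc k) = (-1) ^ k * int (Suc k)"
    by (induction k) (auto simp: algebra_simps)
  then show ?thesis by simp
qed

text \<open>The hypothesis forces \<open>v\<close> to be 2 or -2 modulo \<open>p\<close>, and
  \<open>U_p\<close> takes the values \<open>p\<close> or \<open>-p\<close> up to sign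
  there.\<close>

lemma prime_dvd_lucas_U_self:
  assumes "prime p" "int p dvd v\<^sup>2 - 4"
  shows "int p dvd lucas_U v p"
proof -
  have "v\<^sup>2 - 4 = (v - 2) * (v + 2)"
    by (simp add: algebra_simps power2_eq_square)
  then consider "[v = 2] (mod int p)" | "[v = -2] (mod int p)"
    using assms prime_dvd_mult_iff[of "int p" "v - 2" "v + 2"] by (auto simp: cong_iff_dvd_diff)
  then show ?thesis
  proof cases
    case 1
    then show ?thesis
      using lucas_U_cong[OF 1, of p] by (simp add: lucas_U_2 cong_dvd_iff)
  next
    case 2
    then show ?thesis
      using lucas_U_cong[OF 2, of p] by (simp add: lucas_U_minus_2 cong_dvd_iff)
  qed
qed

text \<open>The hypothesis is a product so as to cover both sources of a factor \<open>p\<close>,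
  namely \<open>u^2 - 4\<close> and \<open>lucas_U u b\<close>.\<close>

lemma prime_power_mult_lucas_U_dvd:
  assumes "prime p" "int p dvd (u\<^sup>2 - 4) * (lucas_U u b)\<^sup>2"
  shows "int p ^ i * lucas_U u b dvd lucas_U u (p ^ i * b)"
proof (induction i)
  case 0
  then show ?case by simp
next
  case (Suc i)
  let ?a = "p ^ i * b"
  \<comment> \<open>Since \<open>U_b\<close> divides \<open>U_a\<close>, the hypothesis passes from
    \<open>b\<close> to every multiple of it.\<close>
  have "(lucas_U u b)\<^sup>2 dvd (lucas_U u ?a)\<^sup>2"
    by (simp add: lucas_U_dvd dvd_power_same)
  then have "int p dvd (lucas_V u ?a)\<^sup>2 - 4"
    unfolding lucas_V_square using assms(2) by (meson dvd_refl dvd_trans mult_dvd_mono)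
  then have "int p dvd lucas_U (lucas_V u ?a) p"
    using assms(1) prime_dvd_lucas_U_self by blast
  then have "(int p ^ i * lucas_U u b) * int p dvd lucas_U u ?a * lucas_U (lucas_V u ?a) p"
    using Suc by (rule mult_dvd_mono[rotated])
  then show ?case
    using lucas_U_mult[of u p ?a] by (simp add: ac_simps)
qed

section \<open>Dickson polynomials as Lucas sequences\<close>

definition dickson_coeff :: "nat \<Rightarrow> nat \<Rightarrow> nat" where
  "dickson_coeff k j = k * ((k - j) choose j) div (k - j)"

lemma dickson_coeff_0: "k \<ge> 1 \<Longrightarrow> dickson_coeff k 0 = 1"
  by (simp add: dickson_coeff_def)

lemma dickson_coeff_eq_0: "k < 2 * j \<Longrightarrow> dickson_coeff k j = 0"
  by (simp add: dickson_coeff_def binomial_eq_0)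

text \<open>Splitting \<open>k = (k - j) + j\<close> and absorbing \<open>j\<close> into the
  binomial removes the quotient. The coefficient recurrence then reduces to Pascal's rule.\<close>

lemma dickson_coeff_add_Suc:
  "dickson_coeff (Suc m + Suc i) (Suc i) = (Suc m choose Suc i) + (m choose i)"
proof -
  have "(Suc m + Suc i) * (Suc m choose Suc i) = Suc m * ((Suc m choose Suc i) + (m choose i))"
    using Suc_times_binomial[of i m] by (simp only: add_mult_distrib add_mult_distrib2)
  then show ?thesis
    unfolding dickson_coeff_def by (simp del: binomial_Suc_Suc mult_Suc)
qed

lemma dickson_coeff_rec:
  assumes "k \<ge> 1"
  shows "dickson_coeff (Suc (Suc k)) (Suc j) = dickson_coeff (Suc k) (Suc j) + dickson_coeff k j"
proof (cases "k < 2 * j")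
  case True
  then show ?thesis by (simp add: dickson_coeff_eq_0)
next
  case False
  then have "k = Suc (k - j - 1) + j"
    using assms by linarith
  then obtain m where m: "k = Suc m + j" ..
  have 1: "dickson_coeff (Suc (Suc k)) (Suc j) = (Suc (Suc m) choose Suc j) + (Suc m choose j)"
    using dickson_coeff_add_Suc[of "Suc m" j] m by simp
  have 2: "dickson_coeff (Suc k) (Suc j) = (Suc m choose Suc j) + (m choose j)"
    using dickson_coeff_add_Suc[of m j] m by simp
  show ?thesis
  proof (cases j)
    case 0
    then show ?thesis
      using 1 2 assms by (simp add: dickson_coeff_0)
  next
    case (Suc i)
    then have "dickson_coeff k j = (Suc m choose Suc i) + (m choose i)"
      using dickson_coeff_add_Suc[of m i] m by simp
    then show ?thesis
      using 1 2 Suc by simp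
  qed
qed

text \<open>Coefficients beyond \<open>k div 2\<close> vanish, so the sums for \<open>k\<close>,
  \<open>k + 1\<close> and \<open>k + 2\<close> can be brought to comparable ranges and matched term
  by term.\<close>

lemma dickson_eq_sum:
  assumes "k div 2 \<le> N"
  shows "dickson k x = (\<Sum>j\<le>N. int (dickson_coeff k j) * (- 1) ^ j * x ^ (k - 2 * j))"
proof -
  have "dickson k x = (\<Sum>j = 0..k div 2. int (dickson_coeff k j) * (- 1) ^ j * x ^ (k - 2 * j))"
    by (simp add: dickson_def dickson_coeff_def)
  also have "\<dots> = (\<Sum>j\<le>N. int (dickson_coeff k j) * (- 1) ^ j * x ^ (k - 2 * j))"
    using assms by (intro sum.mono_neutral_left) (auto intro!: dickson_coeff_eq_0)
  finally show ?thesis .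
qed

lemma dickson_rec:
  assumes "k \<ge> 1"
  shows "dickson (Suc (Suc k)) x = x * dickson (Suc k) x - dickson k x"
proof -
  have lhs: "dickson (Suc (Suc k)) x = x ^ Suc (Suc k) +
      (\<Sum>j\<le>k. int (dickson_coeff (Suc (Suc k)) (Suc j)) * (- 1) ^ Suc j * x ^ (k - 2 * j))"
    using dickson_eq_sum[of "Suc (Suc k)" "Suc k" x]
    by (simp add: sum.atMost_Suc_shift dickson_coeff_0 del: sum.atMost_Suc)
  have mid: "dickson (Suc k) x = x ^ Suc k +
      (\<Sum>j\<le>k. int (dickson_coeff (Suc k) (Suc j)) * (- 1) ^ Suc j * x ^ (Suc k - 2 * Suc j))"
    using dickson_eq_sum[of "Suc k" "Suc k" x]
    by (simp add: sum.atMost_Suc_shift dickson_coeff_0 del: sum.atMost_Suc)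
  \<comment> \<open>Where the truncated exponents would disagree, the coefficient is 0.\<close>
  have pow: "x * (int (dickson_coeff (Suc k) (Suc j)) * (- 1) ^ Suc j * x ^ (Suc k - 2 * Suc j)) =
      int (dickson_coeff (Suc k) (Suc j)) * (- 1) ^ Suc j * x ^ (k - 2 * j)" for j
  proof (cases "Suc k < 2 * Suc j")
    case True
    then show ?thesis by (simp add: dickson_coeff_eq_0)
  next
    case False
    then have "k - 2 * j = Suc (Suc k - 2 * Suc j)" by simp
    then show ?thesis by simp
  qed
  have "x * dickson (Suc k) x - dickson k x = x ^ Suc (Suc k) +
     (\<Sum>j\<le>k. int (dickson_coeff (Suc k) (Suc j)) * (- 1) ^ Suc j * x ^ (k - 2 * j)
           - int (dickson_coeff k j) * (- 1) ^ j * x ^ (k - 2 * j))"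
    unfolding mid dickson_eq_sum[of k k, simplified] distrib_left sum_distrib_left pow
    by (simp add: sum_subtractf)
  also have "\<dots> = dickson (Suc (Suc k)) x"
    unfolding lhs dickson_coeff_rec[OF assms]
    by (intro arg_cong2[where f = "(+)"] sum.cong) (auto simp: algebra_simps)
  finally show ?thesis by simp
qed

text \<open>The induction starts from \<open>k = 1\<close> and \<open>k = 2\<close>, because
  \<open>dickson 0 u\<close> evaluates to 0 while \<open>lucas_V u 0 = 2\<close>.\<close>

lemma dickson_eq_lucas_V:
  assumes "k \<ge> 1"
  shows "dickson k u = lucas_V u k"
  using assms
proof (induction k rule: less_induct)
  case (less k)
  have 1: "dickson (Suc 0) u = u"
    by (simp add: dickson_def)
  have 2: "dickson (Suc (Suc 0)) u = u\<^sup>2 - 2"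
    by (simp add: dickson_def power2_eq_square)
  consider "k = Suc 0" | "k = Suc (Suc 0)" | i where "k = Suc (Suc i)" "i \<ge> 1"
    using less.prems by (metis One_nat_def Suc_le_eq Suc_pred gr0I)
  then show ?case
    using 1 2 less.IH dickson_rec by cases (auto simp: power2_eq_square)
qed

text \<open>For \<open>j \<ge> 1\<close> the coefficient times \<open>p - j\<close> is a multiple of
  \<open>p\<close>, and \<open>p\<close> does not divide \<open>p - j\<close>, so only the leading
  term survives.\<close>

lemma dickson_prime_cong:
  assumes "prime p"
  shows "[dickson p u = u ^ p] (mod int p)"
proof -
  have p: "p \<ge> 2" using assms by (rule prime_ge_2_nat)
  have "int p dvd int (dickson_coeff p j)" if "j \<ge> 1" "j \<le> p div 2" for j
  proof -
    have "(p - j) * dickson_coeff p j = p * ((p - j) choose j)"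
      using dickson_coeff_dvd[of p j] that p by (simp add: dickson_coeff_def)
    then have "p dvd (p - j) * dickson_coeff p j" by simp
    moreover have "\<not> p dvd p - j"
      using that p by (auto dest!: dvd_imp_le)
    ultimately show ?thesis
      using assms by (simp add: prime_dvd_mult_iff)
  qed
  then have "int p dvd (\<Sum>j = Suc 0..p div 2. int (dickson_coeff p j) * (- 1) ^ j * u ^ (p - 2 * j))"
    by (intro dvd_sum) auto
  moreover have "dickson p u = u ^ p +
      (\<Sum>j = Suc 0..p div 2. int (dickson_coeff p j) * (- 1) ^ j * u ^ (p - 2 * j))"
    unfolding dickson_def dickson_coeff_def[symmetric]
    using p by (subst sum.atLeast_Suc_atMost) (auto simp: dickson_coeff_0)
  ultimately show ?thesis
    by (simp add: cong_iff_dvd_diff)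
qed

section \<open>Periodicity modulo prime powers\<close>

lemma fermat_int:
  assumes "prime p"
  shows "[u ^ p = u] (mod int p)"
proof (cases "int p dvd u")
  case True
  then have "int p dvd u ^ p"
    using assms by (meson dvd_power dvd_trans prime_gt_0_nat)
  then show ?thesis
    using True by (simp add: cong_iff_dvd_diff)
next
  case False
  define a where "a = nat (u mod int p)"
  have p: "p > 0" using assms by (rule prime_gt_0_nat)
  have a: "[int a = u] (mod int p)"
    using p by (simp add: a_def cong_def)
  then have "\<not> p dvd a"
    using False by (metis cong_dvd_iff int_dvd_int_iff)
  then have "[a ^ (p - 1) = 1] (mod p)"
    by (rule fermat_theorem[OF assms])
  then have "[int a ^ (p - 1) = 1] (mod int p)"
    using cong_int_iff[of "a ^ (p - 1)" 1 p] by simp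
  then have "[u ^ (p - 1) = 1] (mod int p)"
    using a by (meson cong_pow cong_sym cong_trans)
  then have "[u * u ^ (p - 1) = u * 1] (mod int p)"
    by (intro cong_mult cong_refl)
  then show ?thesis
    using p by (simp add: power_eq_if)
qed

lemma lucas_V_period_odd_prime_power:
  assumes "prime p" "odd p" "f \<ge> 1"
  shows "[lucas_V u (k + p ^ (f - 1) * ((p\<^sup>2 - 1) div 2)) = lucas_V u k] (mod int (p ^ f))"
proof -
  obtain h where h: "p = 2 * h + 1"
    using assms(2) by (rule oddE)
  \<comment> \<open>\<open>b\<close> is a common multiple of \<open>(p - 1) / 2\<close> and
    \<open>(p + 1) / 2\<close>, and \<open>(p^2 - 1) / 2 = 2 * b\<close>; hence \<open>m\<close>
    below is half the period.\<close>
  define b where "b = h * Suc h"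
  define m where "m = p ^ (f - 1) * b"
  have m: "p ^ (f - 1) * ((p\<^sup>2 - 1) div 2) = 2 * m"
    by (simp add: m_def b_def h power2_eq_square algebra_simps)
  \<comment> \<open>\<open>D_p(u) \<equiv> u^p \<equiv> u\<close>, and \<open>D_p(u) - u\<close> factors because \<open>p = 1 + 2h\<close>.\<close>
  have "[lucas_V u p = u] (mod int p)"
    using dickson_prime_cong[OF assms(1), of u] fermat_int[OF assms(1), of u] prime_ge_1_nat[OF assms(1)]
    by (simp add: dickson_eq_lucas_V) (metis cong_trans)
  then have "int p dvd lucas_V u (1 + 2 * h) - lucas_V u 1"
    by (simp add: h cong_iff_dvd_diff)
  then have "int p dvd (u\<^sup>2 - 4) * lucas_U u h * lucas_U u (Suc h)"
    unfolding lucas_V_shift_diff by simp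
  moreover have "lucas_U u h dvd lucas_U u b" "lucas_U u (Suc h) dvd lucas_U u b"
    unfolding b_def by (intro lucas_U_dvd dvd_triv_left dvd_triv_right)+
  ultimately have cases: "int p dvd u\<^sup>2 - 4 \<or> int p dvd lucas_U u b"
    using assms(1) by (auto simp: prime_dvd_mult_iff intro: dvd_trans)
  then have "int p dvd (u\<^sup>2 - 4) * (lucas_U u b)\<^sup>2"
    by (auto simp: power2_eq_square)
  then have dvd: "int p ^ (f - 1) * lucas_U u b dvd lucas_U u m"
    unfolding m_def by (rule prime_power_mult_lucas_U_dvd[OF assms(1)])
  have pf: "int p ^ f = int p ^ (f - 1) * int p"
    using assms(3) by (cases f) auto
  \<comment> \<open>Lifting yields \<open>f - 1\<close> factors \<open>p\<close>; the last one comes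
    from \<open>u^2 - 4\<close> or from \<open>lucas_U u b\<close>.\<close>
  have "int p ^ f dvd (u\<^sup>2 - 4) * lucas_U u m"
    using cases
  proof
    assume "int p dvd u\<^sup>2 - 4"
    moreover have "int p ^ (f - 1) dvd lucas_U u m"
      using dvd by (rule dvd_mult_left)
    ultimately show ?thesis
      unfolding pf by (subst mult.commute) (rule mult_dvd_mono)
  next
    assume "int p dvd lucas_U u b"
    then have "int p ^ f dvd int p ^ (f - 1) * lucas_U u b"
      unfolding pf by (intro mult_dvd_mono) auto
    then show ?thesis
      using dvd by (meson dvd_mult dvd_trans)
  qed
  then show ?thesis
    unfolding m cong_iff_dvd_diff lucas_V_shift_diff by simp
qed

section \<open>Periodicity modulo powers of 2\<close>

lemma even_lucas_V: "even u \<Longrightarrow> even (lucas_V u k)"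
  by (induction u k rule: lucas_V.induct) simp_all

lemma odd_square_minus_1_int:
  assumes "odd (u :: int)"
  shows "8 dvd u\<^sup>2 - 1"
proof -
  obtain t where t: "u = 2 * t + 1"
    using assms by (rule oddE)
  have "even (t * (t + 1))" by simp
  then obtain s where "t * (t + 1) = 2 * s" by (rule evenE)
  then have "u\<^sup>2 - 1 = 8 * s"
    by (simp add: t power2_eq_square algebra_simps)
  then show ?thesis by simp
qed

text \<open>Lifting from index 3 supplies \<open>2 ^ j\<close>. The remaining factor 8 comes from
  \<open>U_3 = u^2 - 1\<close> if \<open>u\<close> is odd, and from \<open>u^2 - 4\<close> if
  \<open>u\<close> is twice an odd number. The delicate case is \<open>4 dvd u\<close>.\<close>

lemma lucas_V_period_two_power_ge_3:
  assumes "odd k"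
  shows "[lucas_V u (k + 2 * (2 ^ j * 3)) = lucas_V u k] (mod 2 ^ (j + 3))"
proof -
  define m where "m = 2 ^ j * (3 :: nat)"
  have U3: "lucas_U u 3 = u\<^sup>2 - 1"
    by (simp add: numeral_3_eq_3 power2_eq_square)
  have lift: "2 ^ i * lucas_U u b dvd lucas_U u (2 ^ i * b)" if "even u \<or> even (lucas_U u b)" for i b
    using prime_power_mult_lucas_U_dvd[of 2 u b i] that by auto
  have "2 ^ (j + 3) dvd (u\<^sup>2 - 4) * lucas_U u m * lucas_U u (k + m)"
  proof (cases "even u")
    case False
    have 8: "8 dvd lucas_U u 3"
      unfolding U3 using False by (rule odd_square_minus_1_int)
    then have "even (lucas_U u 3)"
      by (rule dvd_trans[rotated]) simp
    then have "2 ^ j * lucas_U u 3 dvd lucas_U u m"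
      unfolding m_def by (intro lift) simp
    moreover have "2 ^ (j + 3) dvd 2 ^ j * lucas_U u 3"
      using 8 by (simp add: power_add)
    ultimately show ?thesis
      by (meson dvd_mult dvd_mult2 dvd_trans)
  next
    case True
    then obtain t where t: "u = 2 * t" by (rule evenE)
    have sq: "u\<^sup>2 - 4 = 4 * (t\<^sup>2 - 1)"
      by (simp add: t power2_eq_square)
    have Um: "2 ^ j dvd lucas_U u m"
      using lift[of 3 j] True unfolding m_def by (meson dvd_mult_left)
    show ?thesis
    proof (cases "even t")
      case False
      then have "8 dvd u\<^sup>2 - 4"
        unfolding sq using odd_square_minus_1_int by (meson dvd_mult)
      then have "8 * 2 ^ j dvd (u\<^sup>2 - 4) * lucas_U u m"
        using Um by (rule mult_dvd_mono)
      then show ?thesis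
        by (simp add: power_add mult.commute)
    next
      case True
      \<comment> \<open>Here \<open>u^2 - 4\<close> is only used for a factor 4, so one extra 2 is
        needed. For \<open>j = 0\<close> it comes from \<open>U_2 = u\<close> dividing
        \<open>U_{k+3}\<close>, as \<open>k + 3\<close> is even; this is where \<open>k\<close> odd
        enters. For \<open>j > 0\<close>, lifting from index 6 instead of 3 starts with a factor
        4.\<close>
      have "2 * 2 ^ j dvd lucas_U u m * lucas_U u (k + m)"
      proof (cases j)
        case 0
        have "lucas_U u 2 dvd lucas_U u (k + m)"
          using assms 0 by (intro lucas_U_dvd) (simp add: m_def)
        then have "2 dvd lucas_U u (k + m)"
          by (simp add: numeral_2_eq_2 t) (meson dvd_mult_left)
        then show ?thesis
          using 0 by simp
      next
        case (Suc i)
        have "lucas_U u 2 dvd lucas_U u 6"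
          by (intro lucas_U_dvd) simp
        moreover have "4 dvd u"
          using True t by auto
        ultimately have "4 dvd lucas_U u 6"
          by (simp add: numeral_2_eq_2) (meson dvd_trans)
        then have "2 ^ i * 4 dvd 2 ^ i * lucas_U u 6"
          by (intro mult_dvd_mono) auto
        also have "\<dots> dvd lucas_U u (2 ^ i * 6)"
          using \<open>even u\<close> by (intro lift) simp
        also have "2 ^ i * 6 = m"
          by (simp add: m_def Suc)
        finally show ?thesis
          using Suc by (simp add: mult.commute)
      qed
      moreover have "4 dvd u\<^sup>2 - 4"
        unfolding sq by simp
      ultimately have "4 * (2 * 2 ^ j) dvd (u\<^sup>2 - 4) * (lucas_U u m * lucas_U u (k + m))"
        by (rule mult_dvd_mono[rotated])
      then show ?thesis
        by (simp add: power_add ac_simps)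
    qed
  qed
  then show ?thesis
    unfolding cong_iff_dvd_diff m_def[symmetric] lucas_V_shift_diff .
qed

text \<open>
  The restriction to odd \<open>k\<close> is necessary: \<open>D_2(0) = -2\<close> and \<open>D_8(0) = 2\<close> differ modulo 8.
  It costs nothing because units modulo the period are odd as soon as \<open>e \<ge> 2\<close>.
\<close>

lemma lucas_V_period_two_power:
  assumes "e \<ge> 1" "e \<ge> 3 \<Longrightarrow> odd k"
  shows "[lucas_V u (k + (if e < 3 then 3 * 2 ^ (e - 1) else 3 * 2 ^ (e - 2))) = lucas_V u k]
    (mod int (2 ^ e))"
proof -
  consider "e = 1" | "e = 2" | "e \<ge> 3"
    using assms(1) by linarith
  then show ?thesis
  proof cases
    case 1
    \<comment> \<open>The period 3 is odd, so \<open>lucas_V_shift_diff\<close> does not apply and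
      the recurrence is expanded. For odd \<open>u\<close> both coefficients are even; for even
      \<open>u\<close> both values of \<open>lucas_V\<close> are.\<close>
    have "lucas_V u (k + 3) - lucas_V u k =
        (u\<^sup>2 - 1) * lucas_V u (Suc k) - (u + 1) * lucas_V u k"
      by (simp add: numeral_3_eq_3 power2_eq_square algebra_simps)
    moreover have "even \<dots>"
      using even_lucas_V[of u] by (cases "even u") auto
    ultimately show ?thesis
      using 1 by (simp add: cong_iff_dvd_diff)
  next
    case 2
    have "4 dvd (u\<^sup>2 - 4) * lucas_U u 3"
    proof (cases "even u")
      case True
      then show ?thesis by (auto elim!: evenE simp: power2_eq_square)
    next
      case False
      then have "8 dvd u\<^sup>2 - 1" by (rule odd_square_minus_1_int)
      then have "4 dvd u\<^sup>2 - 1" by (rule dvd_trans[rotated]) simp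
      then show ?thesis
        by (simp add: numeral_3_eq_3 power2_eq_square)
    qed
    then have "4 dvd lucas_V u (k + 2 * 3) - lucas_V u k"
      unfolding lucas_V_shift_diff by (rule dvd_mult2)
    then show ?thesis
      using 2 by (simp add: cong_iff_dvd_diff)
  next
    case 3
    then obtain j where "e = j + 3"
      by (metis add.commute le_Suc_ex)
    then show ?thesis
      using lucas_V_period_two_power_ge_3[of k u j] assms(2) by (simp add: ac_simps)
  qed
qed

section \<open>Gluing the kernels\<close>

text \<open>Only indices coprime to the period are considered: these are the ones in the kernels,
  and modulo 8 periodicity fails for even indices. The bound \<open>k \<ge> 1\<close> avoids the
  value of \<open>dickson\<close> at 0.\<close>

definition dickson_periodic :: "nat \<Rightarrow> nat \<Rightarrow> bool" where
  "dickson_periodic q L \<longleftrightarrow>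
     (\<forall>k u. k \<ge> 1 \<longrightarrow> coprime k L \<longrightarrow> [dickson (k + L) u = dickson k u] (mod int q))"

lemma dickson_periodic_shift:
  assumes "dickson_periodic q L" "k \<ge> 1" "coprime k L"
  shows "[dickson (k + j * L) u = dickson k u] (mod int q)"
proof (induction j)
  case 0
  then show ?case by simp
next
  case (Suc j)
  have "coprime (k + j * L) L"
    using assms(3) by (rule cong_imp_coprime[rotated]) (simp add: cong_def)
  then have "[dickson (k + j * L + L) u = dickson (k + j * L) u] (mod int q)"
    using assms(1,2) by (simp add: dickson_periodic_def)
  then have "[dickson (k + j * L + L) u = dickson k u] (mod int q)"
    using Suc by (rule cong_trans)
  then show ?case
    by (simp add: ac_simps)
qed

lemma dickson_periodic_cong:
  assumes per: "dickson_periodic q L" and "x > 0" "y > 0"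
    and cop: "coprime x (int L)" and xy: "[x = y] (mod int L)"
  shows "[dickson (nat x) u = dickson (nat y) u] (mod int q)"
proof -
  have main: "[dickson (nat b) u = dickson (nat a) u] (mod int q)"
    if a: "a > 0" and le: "a \<le> b" and ca: "coprime a (int L)" and ab: "[b = a] (mod int L)" for a b
  proof -
    have "int L dvd b - a"
      using ab by (simp add: cong_iff_dvd_diff)
    then obtain c where c: "b - a = int L * c" ..
    define j where "j = nat c"
    have "nat b = nat a + j * L"
    proof (cases "L = 0")
      case True
      then show ?thesis using c by simp
    next
      case False
      moreover have "0 \<le> int L * c"
        using c le by simp
      ultimately have "c \<ge> 0"
        by (simp add: zero_le_mult_iff)
      then have "b = a + int (j * L)"
        using c by (simp add: j_def algebra_simps)
      then show ?thesis
        using a by (simp add: nat_add_distrib del: of_nat_mult)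
    qed
    moreover have "coprime (nat a) L"
      using ca a by (simp flip: coprime_int_iff)
    ultimately show ?thesis
      using dickson_periodic_shift[OF per, of "nat a" j u] a by simp
  qed
  have "coprime y (int L)"
    using cop xy cong_imp_coprime by blast
  then show ?thesis
    using main[of x y] main[of y x] assms by (cases "x \<le> y") (auto intro: cong_sym)
qed

lemma mem_dickson_kernel_iff:
  assumes "L > 1"
  shows "k \<in> dickson_kernel q L \<longleftrightarrow>
    0 < k \<and> k < int L \<and> coprime k (int L) \<and> (\<forall>u. [dickson (nat k) u = u] (mod int q))"
proof -
  interpret residues "int L" "residue_ring (int L)"
    using assms by unfold_locales auto
  show ?thesis
    by (auto simp: dickson_kernel_def res_units_eq)
qed

text \<open>This makes the class of the solution chosen by \<open>SOME\<close> independent of the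
  choice.\<close>

lemma solves_unique_mod_Lcm:
  assumes "solves I l a x" "solves I l a y"
  shows "[x = y] (mod int (Lcm (l ` I)))"
proof -
  have "l i dvd nat \<bar>x - y\<bar>" if "i \<in> I" for i
  proof -
    have "[x = y] (mod int (l i))"
      using assms that unfolding solves_def by (metis cong_sym cong_trans)
    then show ?thesis
      by (simp add: cong_iff_dvd_diff)
  qed
  then have "Lcm (l ` I) dvd nat \<bar>x - y\<bar>"
    by (intro Lcm_least) auto
  then show ?thesis
    by (simp add: cong_iff_dvd_diff)
qed

lemma coprime_Lcm_int:
  assumes "finite I" "\<And>i. i \<in> I \<Longrightarrow> coprime x (int (l i))"
  shows "coprime x (int (Lcm (l ` I)))"
proof -
  have "Lcm (l ` I) dvd (\<Prod>i\<in>I. l i)"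
    using assms(1) by (intro Lcm_least) auto
  then have "int (Lcm (l ` I)) dvd (\<Prod>i\<in>I. int (l i))"
    by (metis int_dvd_int_iff of_nat_prod)
  moreover have "coprime x (\<Prod>i\<in>I. int (l i))"
    using assms(2) by (intro prod_coprime_right)
  ultimately show ?thesis
    by (meson coprime_divisors dvd_refl)
qed

text \<open>One argument serves both index sets. The \<open>l i\<close> may share factors, so
  solvability is demanded in \<open>compatible_tuples\<close>; the \<open>q i\<close> are pairwise
  coprime, so congruences modulo all of them combine to one modulo \<open>N\<close>.\<close>

lemma compatible_tuples_bij_dickson_kernel:
  fixes l q :: "nat \<Rightarrow> nat" and I :: "nat set"
  defines "W \<equiv> Lcm (l ` I)"
  defines "\<rho> \<equiv> \<lambda>a. (SOME x. solves I l a x) mod int W"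
  assumes fin: "finite I" and ne: "I \<noteq> {}"
    and l_gt: "\<And>i. i \<in> I \<Longrightarrow> l i > 1"
    and per: "\<And>i. i \<in> I \<Longrightarrow> dickson_periodic (q i) (l i)"
    and cop: "\<And>i j. i \<in> I \<Longrightarrow> j \<in> I \<Longrightarrow> i \<noteq> j \<Longrightarrow> coprime (q i) (q j)"
    and N: "N = (\<Prod>i\<in>I. q i)"
  shows "(\<forall>a\<in>compatible_tuples I q l. \<forall>x. solves I l a x \<longrightarrow> \<rho> a = x mod int W) \<and>
    bij_betw \<rho> (compatible_tuples I q l) (dickson_kernel N W)"
proof -
  have l_dvd: "int (l i) dvd int W" if "i \<in> I" for i
    using that by (simp add: W_def)
  have "W \<noteq> 0"
    using fin l_gt unfolding W_def by (subst Lcm_0_iff) force+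
  obtain i0 where i0: "i0 \<in> I" using ne by blast
  have "l i0 \<le> W"
    using l_dvd[OF i0] \<open>W \<noteq> 0\<close> by (auto intro: dvd_imp_le)
  then have W_gt: "W > 1"
    using l_gt[OF i0] by simp
  have rho_eq: "\<rho> a = x mod int W" if "solves I l a x" for a x
    using solves_unique_mod_Lcm[OF someI[of "solves I l a", OF that] that]
    by (simp add: \<rho>_def W_def cong_def)
  have modl: "[x mod int W = x] (mod int (l i))" if "i \<in> I" for i x
    by (rule cong_dvd_modulus[OF _ l_dvd[OF that]]) (simp add: cong_def)
  \<comment> \<open>The inverse map; restricting to \<open>I\<close> makes its values extensional,
    as membership in the \<open>PiE\<close> set requires.\<close>
  define \<tau> where "\<tau> k = (\<lambda>i\<in>I. k mod int (l i))" for k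
  have left: "\<tau> (\<rho> a) = a" and into: "\<rho> a \<in> dickson_kernel N W"
    if a: "a \<in> compatible_tuples I q l" for a
  proof -
    from a obtain x where x: "solves I l a x" and a: "a \<in> (\<Pi>\<^sub>E i\<in>I. dickson_kernel (q i) (l i))"
      by (auto simp: compatible_tuples_def)
    have k: "\<rho> a = x mod int W" using x by (rule rho_eq)
    have ai: "0 < a i" "a i < int (l i)" "coprime (a i) (int (l i))"
      "\<And>u. [dickson (nat (a i)) u = u] (mod int (q i))" if "i \<in> I" for i
      using a that mem_dickson_kernel_iff[OF l_gt[OF that], of "a i" "q i"] by (auto simp: PiE_iff)
    have cong: "[\<rho> a = a i] (mod int (l i))" if "i \<in> I" for i
      using x that modl[OF that, of x] unfolding k solves_def by (metis cong_trans)
    have "\<tau> (\<rho> a) i = a i" for i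
    proof (cases "i \<in> I")
      case True
      then show ?thesis
        using cong[OF True] ai[OF True] by (simp add: \<tau>_def cong_def)
    next
      case False
      then show ?thesis
        using PiE_arb[OF a False] by (simp add: \<tau>_def)
    qed
    then show "\<tau> (\<rho> a) = a" by (rule ext)
    have copi: "coprime (\<rho> a) (int (l i))" if "i \<in> I" for i
      using cong[OF that] ai(3)[OF that] by (meson cong_imp_coprime cong_sym)
    then have copW: "coprime (\<rho> a) (int W)"
      unfolding W_def by (rule coprime_Lcm_int[OF fin])
    \<comment> \<open>As \<open>W > 1\<close>, coprimality to \<open>W\<close> excludes 0, so
      \<open>nat\<close> yields an index at least 1.\<close>
    have "\<rho> a \<noteq> 0"
      using copW W_gt by auto
    moreover have "0 \<le> \<rho> a" "\<rho> a < int W"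
      using W_gt by (auto simp: k)
    ultimately have pos: "0 < \<rho> a" "\<rho> a < int W" by auto
    \<comment> \<open>Periodicity modulo \<open>q i\<close> carries the kernel condition from
      \<open>a i\<close> to \<open>\<rho> a\<close>, which agree modulo \<open>l i\<close>.\<close>
    have "[dickson (nat (\<rho> a)) u = u] (mod int (q i))" if "i \<in> I" for i u
      using dickson_periodic_cong[OF per[OF that] pos(1) ai(1)[OF that] copi[OF that] cong[OF that]]
        ai(4)[OF that] by (rule cong_trans)
    then have "[dickson (nat (\<rho> a)) u = u] (mod (\<Prod>i\<in>I. int (q i)))" for u
      using cop by (intro cong_cong_prod_coprime) auto
    then show "\<rho> a \<in> dickson_kernel N W"
      using pos copW mem_dickson_kernel_iff[OF W_gt] by (simp add: N)
  qed
  have right: "\<rho> (\<tau> k) = k" and onto: "\<tau> k \<in> compatible_tuples I q l"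
    if "k \<in> dickson_kernel N W" for k
  proof -
    have k: "0 < k" "k < int W" "coprime k (int W)" "\<And>u. [dickson (nat k) u = u] (mod int N)"
      using that mem_dickson_kernel_iff[OF W_gt] by auto
    have sol: "solves I l (\<tau> k) k"
      by (simp add: solves_def \<tau>_def cong_def)
    show "\<rho> (\<tau> k) = k"
      using rho_eq[OF sol] k by simp
    have "k mod int (l i) \<in> dickson_kernel (q i) (l i)" if i: "i \<in> I" for i
    proof -
      have ck: "coprime k (int (l i))"
        using k(3) l_dvd[OF i] by (meson coprime_divisors dvd_refl)
      have cong: "[k = k mod int (l i)] (mod int (l i))"
        by (simp add: cong_def)
      have c: "coprime (k mod int (l i)) (int (l i))"
        using ck cong by (rule cong_imp_coprime[rotated])
      then have "k mod int (l i) \<noteq> 0"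
        using l_gt[OF i] by auto
      moreover have "0 \<le> k mod int (l i)" "k mod int (l i) < int (l i)"
        using l_gt[OF i] by auto
      ultimately have pos: "0 < k mod int (l i)" "k mod int (l i) < int (l i)" by auto
      have "int (q i) dvd int N"
        unfolding N int_dvd_int_iff using fin i by (rule dvd_prodI)
      then have "[dickson (nat k) u = u] (mod int (q i))" for u
        by (rule cong_dvd_modulus[OF k(4)])
      then have "[dickson (nat (k mod int (l i))) u = u] (mod int (q i))" for u
        using dickson_periodic_cong[OF per[OF i] k(1) pos(1) ck cong, of u]
        by (meson cong_sym cong_trans)
      then show ?thesis
        using pos c mem_dickson_kernel_iff[OF l_gt[OF i]] by simp
    qed
    then show "\<tau> k \<in> compatible_tuples I q l"
      using sol by (auto simp: compatible_tuples_def \<tau>_def)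
  qed
  have "bij_betw \<rho> (compatible_tuples I q l) (dickson_kernel N W)"
    by (rule bij_betw_byWitness[where f' = \<tau>]) (use left into right onto in auto)
  then show ?thesis
    using rho_eq by blast
qed

section \<open>The concrete moduli and the final assembly\<close>

lemma dickson_periodic_odd_prime_power:
  assumes "prime p" "odd p" "f \<ge> 1"
  shows "dickson_periodic (p ^ f) (p ^ (f - 1) * ((p\<^sup>2 - 1) div 2))"
  unfolding dickson_periodic_def
proof (intro allI impI)
  fix k :: nat and u :: int
  let ?L = "p ^ (f - 1) * ((p\<^sup>2 - 1) div 2)"
  assume "k \<ge> 1"
  then have "dickson (k + ?L) u = lucas_V u (k + ?L)" "dickson k u = lucas_V u k"
    by (auto intro!: dickson_eq_lucas_V)
  then show "[dickson (k + ?L) u = dickson k u] (mod int (p ^ f))"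
    using lucas_V_period_odd_prime_power[OF assms] by simp
qed

lemma dickson_periodic_two_power:
  assumes "e \<ge> 1"
  shows "dickson_periodic (2 ^ e) (if e < 3 then 3 * 2 ^ (e - 1) else 3 * 2 ^ (e - 2))"
  unfolding dickson_periodic_def
proof (intro allI impI)
  fix k u
  let ?L = "if e < 3 then 3 * 2 ^ (e - 1) else 3 * 2 ^ (e - 2) :: nat"
  assume k: "k \<ge> 1" "coprime k ?L"
  \<comment> \<open>For \<open>e \<ge> 3\<close> the period \<open>3 * 2 ^ (e - 2)\<close> is even,
    so coprimality rules out even \<open>k\<close>.\<close>
  have "odd k" if "e \<ge> 3"
  proof
    assume "even k"
    moreover have "even ?L" using that by simp
    ultimately show False
      using k(2) by (meson coprime_common_divisor odd_one)
  qed
  then show "[dickson (k + ?L) u = dickson k u] (mod int (2 ^ e))"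
    using lucas_V_period_two_power[OF assms, of k u] k(1) by (simp add: dickson_eq_lucas_V)
qed

theorem theorem4p7:
  fixes n e r :: nat and p f :: "nat \<Rightarrow> nat"
  assumes n_eq: "n = 2 ^ e * (\<Prod>i = 1..r. p i ^ f i)"
    and n_ge: "n \<ge> 2"
    and r_ge: "e = 0 \<Longrightarrow> r \<ge> 1"
    and primes: "\<And>i. i \<in> {1..r} \<Longrightarrow> prime (p i) \<and> odd (p i)"
    and distinct: "inj_on p {1..r}"
    and exps: "\<And>i. i \<in> {1..r} \<Longrightarrow> f i \<ge> 1"
  shows "(e = 0 \<longrightarrow>
            (\<forall>a\<in>A1 e r p f. \<forall>x. solves {1..r} (period e p f) a x
               \<longrightarrow> rho1 e r p f a = x mod int (w e r p f)) \<and>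
            bij_betw (rho1 e r p f) (A1 e r p f) (dickson_kernel n (w e r p f))) \<and>
         (e \<ge> 1 \<longrightarrow>
            (\<forall>a\<in>A0 e r p f. \<forall>x. solves {0..r} (period e p f) a x
               \<longrightarrow> rho0 e r p f a = x mod int (w e r p f)) \<and>
            bij_betw (rho0 e r p f) (A0 e r p f) (dickson_kernel n (w e r p f)))"
proof -
  let ?q = "prime_pow e p f" and ?l = "period e p f"
  have odd_part: "?l i > 1" "dickson_periodic (?q i) (?l i)" if "i \<in> {1..r}" for i
  proof -
    have pi: "prime (p i)" "odd (p i)" using primes that by auto
    then have "p i \<ge> 2" "p i \<noteq> 2"
      using prime_ge_2_nat by auto
    then have ge: "p i \<ge> 3" by linarith
    then have "(p i)\<^sup>2 \<ge> 3\<^sup>2" by (intro power_mono) auto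
    then have "((p i)\<^sup>2 - 1) div 2 > 1" by simp
    moreover have "p i ^ (f i - 1) \<ge> 1" using ge by simp
    ultimately have "p i ^ (f i - 1) * (((p i)\<^sup>2 - 1) div 2) > 1"
      by (metis less_le_trans mult_le_mono1 nat_mult_1)
    then show "?l i > 1"
      using that by (simp add: period_def)
    show "dickson_periodic (?q i) (?l i)"
      using dickson_periodic_odd_prime_power[OF pi exps[OF that]] that
      by (simp add: period_def prime_pow_def)
  qed
  have odd_coprime: "coprime (?q i) (?q j)" if "i \<in> {1..r}" "j \<in> {1..r}" "i \<noteq> j" for i j
  proof -
    have "coprime (p i) (p j)"
      using primes that distinct by (intro primes_coprime) (auto dest: inj_onD)
    then show ?thesis
      using that by (simp add: prime_pow_def)
  qed
  have prod_q: "(\<Prod>i = 1..r. ?q i) = (\<Prod>i = 1..r. p i ^ f i)"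
    by (intro prod.cong) (auto simp: prime_pow_def)
  show ?thesis
  \<comment> \<open>Only the outer conjunction is split: each half is a single instance of the
    gluing lemma.\<close>
  proof (intro conjI[of "_ \<longrightarrow> _"] impI)
    assume e: "e = 0"
    have "n = (\<Prod>i\<in>{1..r}. ?q i)"
      using n_eq e prod_q by simp
    then have "(\<forall>a\<in>compatible_tuples {1..r} ?q ?l. \<forall>x. solves {1..r} ?l a x \<longrightarrow>
          (SOME x. solves {1..r} ?l a x) mod int (Lcm (?l ` {1..r})) = x mod int (Lcm (?l ` {1..r}))) \<and>
        bij_betw (\<lambda>a. (SOME x. solves {1..r} ?l a x) mod int (Lcm (?l ` {1..r})))
          (compatible_tuples {1..r} ?q ?l) (dickson_kernel n (Lcm (?l ` {1..r})))"
      using r_ge[OF e] odd_part odd_coprime by (intro compatible_tuples_bij_dickson_kernel) auto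
    moreover have "rho1 e r p f = (\<lambda>a. (SOME x. solves {1..r} ?l a x) mod int (Lcm (?l ` {1..r})))"
      using e by (simp add: fun_eq_iff rho1_def w_def)
    moreover have "w e r p f = Lcm (?l ` {1..r})"
      using e by (simp add: w_def)
    ultimately show "(\<forall>a\<in>A1 e r p f. \<forall>x. solves {1..r} ?l a x \<longrightarrow>
          rho1 e r p f a = x mod int (w e r p f)) \<and>
        bij_betw (rho1 e r p f) (A1 e r p f) (dickson_kernel n (w e r p f))"
      unfolding A1_def by simp
  next
    assume e: "e \<ge> 1"
    have I: "{0..r} = insert 0 {1..r}" by auto
    have n: "n = (\<Prod>i\<in>{0..r}. ?q i)"
      using n_eq prod_q by (simp add: I prime_pow_def)
    have part: "?l i > 1" "dickson_periodic (?q i) (?l i)" if "i \<in> {0..r}" for i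
    proof -
      have "1 < 3 * (2 :: nat) ^ k" for k
        using one_le_power[of "2 :: nat" k] by linarith
      then have "?l 0 > 1"
        by (simp add: period_def)
      moreover have "dickson_periodic (?q 0) (?l 0)"
        using dickson_periodic_two_power[OF e] by (simp add: period_def prime_pow_def)
      ultimately show "?l i > 1" "dickson_periodic (?q i) (?l i)"
        using odd_part that by (auto simp: I)
    qed
    have zero: "coprime (?q 0) (?q i)" if "i \<in> {1..r}" for i
      using primes[OF that] that by (simp add: prime_pow_def coprime_left_2_iff_odd)
    have cop: "coprime (?q i) (?q j)" if "i \<in> {0..r}" "j \<in> {0..r}" "i \<noteq> j" for i j
    proof -
      consider "i = 0" "j \<in> {1..r}" | "j = 0" "i \<in> {1..r}" | "i \<in> {1..r}" "j \<in> {1..r}"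
        using \<open>i \<in> {0..r}\<close> \<open>j \<in> {0..r}\<close> \<open>i \<noteq> j\<close> unfolding I by blast
      then show ?thesis
        using zero[of i] zero[of j] odd_coprime[of i j] \<open>i \<noteq> j\<close> by cases (auto simp: coprime_commute)
    qed
    have "(\<forall>a\<in>compatible_tuples {0..r} ?q ?l. \<forall>x. solves {0..r} ?l a x \<longrightarrow>
          (SOME x. solves {0..r} ?l a x) mod int (Lcm (?l ` {0..r})) = x mod int (Lcm (?l ` {0..r}))) \<and>
        bij_betw (\<lambda>a. (SOME x. solves {0..r} ?l a x) mod int (Lcm (?l ` {0..r})))
          (compatible_tuples {0..r} ?q ?l) (dickson_kernel n (Lcm (?l ` {0..r})))"
      using part cop n by (intro compatible_tuples_bij_dickson_kernel) auto
    moreover have "rho0 e r p f = (\<lambda>a. (SOME x. solves {0..r} ?l a x) mod int (Lcm (?l ` {0..r})))"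
      using e by (simp add: fun_eq_iff rho0_def w_def)
    moreover have "w e r p f = Lcm (?l ` {0..r})"
      using e by (simp add: w_def)
    ultimately show "(\<forall>a\<in>A0 e r p f. \<forall>x. solves {0..r} ?l a x \<longrightarrow>
          rho0 e r p f a = x mod int (w e r p f)) \<and>
        bij_betw (rho0 e r p f) (A0 e r p f) (dickson_kernel n (w e r p f))"
      unfolding A0_def by simp
  qed
qed

end
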